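(* Let $S=(a_1,a_2,a_3,\dots)$ be a non-decreasing sequence of positive integers and let $G$ be a connected graph. Then the following holds. (1) If $a_3=1$, then $\chi_S''(G)=3$ if and only if $G$ is a path $P_n$, $n\geq 2$, or $G$ is a cycle $C_n$ such that $n\equiv 0 \pmod 3$. (2) If $a_3\geq 2$ and $a_2=1$, then $\chi_S''(G)=3$ if and only if $G$ is either a path $P_2$ or a path $P_3$. (3) If $a_3\geq 2$ and $a_2\geq 2$, then $\chi_S''(G)=3$ if and only if $G$ is a path $P_2$.
   Context: All graphs are simple and undirected; $P_n$ and $C_n$ (with $n\geq 3$ for cycles) denote the path and the cycle on $n$ vertices, and "is" means "is isomorphic to". For vertices $u,v$ of $G$, $d(u,v)$ is the usual shortest-path distance. For a vertex $u$ and an edge $ab$, $d(u,ab)=d(ab,u)=\min\{d(u,a),d(u,b)\}+1$. For two distinct edges $ab,cd$, $d(ab,cd)=\min\{d(a,c),d(a,d),d(b,c),d(b,d)\}+1$. For a non-decreasing sequence $S=(a_1,a_2,\ldots)$ of positive integers, an $S$-packing total coloring of $G$ using $k$ colors is a map $c:V(G)\cup E(G)\to\{1,\ldots,k\}$ such that any two distinct elements $A,B\in V(G)\cup E(G)$ with $c(A)=c(B)=i$ satisfy $d(A,B)>a_i$. The $S$-packing total chromatic number $\chi_S''(G)$ is the smallest $k$ for which such a coloring exists. *)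

theory Defs
  imports Main "HOL-Library.Extended_Nat" "HOL-Library.FuncSet"
begin

record 'a ugraph =
  verts :: "'a set"
  edges :: "'a set set"

definition simple_graph :: "'a ugraph \<Rightarrow> bool" where
  "simple_graph G \<longleftrightarrow>
     finite (verts G) \<and> edges G \<subseteq> {e. e \<subseteq> verts G \<and> card e = 2}"

definition paths_between :: "'a ugraph \<Rightarrow> 'a \<Rightarrow> 'a \<Rightarrow> 'a list set" where
  "paths_between G u v =
     {p. p \<noteq> [] \<and> hd p = u \<and> last p = v \<and> distinct p \<and> set p \<subseteq> verts G \<and>
         successively (\<lambda>x y. {x, y} \<in> edges G) p}"

definition connected_graph :: "'a ugraph \<Rightarrow> bool" where
  "connected_graph G \<longleftrightarrow>
     verts G \<noteq> {} \<and> (\<forall>u \<in> verts G. \<forall>v \<in> verts G. paths_between G u v \<noteq> {})"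

text \<open>The length of a path is its number of edges; the distance of vertices that no path
  joins is \<open>\<infinity>\<close>.\<close>

definition vertex_dist :: "'a ugraph \<Rightarrow> 'a \<Rightarrow> 'a \<Rightarrow> enat" where
  "vertex_dist G u v = (INF p \<in> paths_between G u v. enat (length p - 1))"

text \<open>The set \<open>V(G) \<union> E(G)\<close> is the disjoint sum \<open>verts G <+> edges G\<close>. The last equation is
  meant for two distinct edges only.\<close>

fun elem_dist :: "'a ugraph \<Rightarrow> 'a + 'a set \<Rightarrow> 'a + 'a set \<Rightarrow> enat" where
  "elem_dist G (Inl u) (Inl v) = vertex_dist G u v"
| "elem_dist G (Inl u) (Inr e) = (MIN a \<in> e. vertex_dist G u a) + 1"
| "elem_dist G (Inr e) (Inl u) = (MIN a \<in> e. vertex_dist G u a) + 1"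
| "elem_dist G (Inr e) (Inr f) = (MIN (a, b) \<in> e \<times> f. vertex_dist G a b) + 1"

text \<open>Sequences are indexed from 1; the value \<open>a 0\<close> is never used.\<close>

definition packing_total_coloring ::
    "(nat \<Rightarrow> nat) \<Rightarrow> 'a ugraph \<Rightarrow> nat \<Rightarrow> ('a + 'a set \<Rightarrow> nat) \<Rightarrow> bool" where
  "packing_total_coloring a G k c \<longleftrightarrow>
     c \<in> (verts G <+> edges G) \<rightarrow> {1..k} \<and>
     (\<forall>A \<in> verts G <+> edges G. \<forall>B \<in> verts G <+> edges G.
        A \<noteq> B \<longrightarrow> c A = c B \<longrightarrow> elem_dist G A B > enat (a (c A)))"

text \<open>On a finite graph an injective coloring witnesses that the minimum exists.\<close>

definition packing_total_chromatic_number :: "(nat \<Rightarrow> nat) \<Rightarrow> 'a ugraph \<Rightarrow> nat" where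
  "packing_total_chromatic_number a G = (LEAST k. \<exists>c. packing_total_coloring a G k c)"

definition graph_iso :: "'a ugraph \<Rightarrow> 'b ugraph \<Rightarrow> bool" where
  "graph_iso G H \<longleftrightarrow>
     (\<exists>f. bij_betw f (verts G) (verts H) \<and>
          (\<forall>u \<in> verts G. \<forall>v \<in> verts G. {u, v} \<in> edges G \<longleftrightarrow> {f u, f v} \<in> edges H))"

definition path_graph :: "nat \<Rightarrow> nat ugraph" where
  "path_graph n = \<lparr>verts = {..<n}, edges = {{i, i + 1} | i. i + 1 < n}\<rparr>"

text \<open>A cycle only for \<open>n \<ge> 3\<close>.\<close>

definition cycle_graph :: "nat \<Rightarrow> nat ugraph" where
  "cycle_graph n = \<lparr>verts = {..<n}, edges = {{i, (i + 1) mod n} | i. i < n}\<rparr>"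

end

theory Submission
  imports Defs
begin

text \<open>
  Three colors leave no freedom: if \<open>u\<close>, \<open>v\<close>, \<open>w\<close> are consecutive vertices, then the edge
  \<open>{v, w}\<close> has the color of \<open>u\<close>, the edge \<open>{u, v}\<close> has the color of \<open>w\<close>, and \<open>u\<close>, \<open>v\<close>, \<open>w\<close> have
  three different colors (\<open>three_colors_on_cherry\<close>). So the vertices of a closed neighborhood have
  different colors and the degrees are at most 2, which makes a connected graph a path or a
  cycle (\<open>path_or_cycle\<close>).

  The vertex colors around a cycle are therefore periodic with period 3, which forces
  \<open>3 dvd n\<close> (\<open>cycle_length_mod_3\<close>). Moreover, the equal colors of \<open>u\<close> and \<open>{v, w}\<close> occur at distance
  2, so \<open>a i = 1\<close> for this color \<open>i\<close>. Three consecutive vertices thus already give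
  two colors \<open>i\<close> with \<open>a i = 1\<close>, hence \<open>a 2 = 1\<close>; a walk of three edges without turning back
  gives all three, hence \<open>a 3 = 1\<close> (\<open>cherry_imp_a2\<close>, \<open>walk_imp_a3\<close>). Such a walk exists in
  every cycle and in every path with at least four vertices.

  Conversely, let \<open>h\<close> number the vertices along a path, or along a cycle whose length is divisible
  by 3, and give a vertex \<open>u\<close> the label \<open>2 * h u\<close> and an edge \<open>{u, v}\<close> the label \<open>h u + h v\<close>. Modulo 3
  these labels are a coloring in which adjacent or incident elements differ. That is
  enough if \<open>a 3 = 1\<close>. On a path with at most three vertices the last color is used only once, and
  on a path with two vertices no color is repeated, which settles the other two cases.
\<close>

section \<open>Distances in the total graph\<close>

lemma edgeD:
  assumes "simple_graph G" "{u, v} \<in> edges G"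
  shows "u \<in> verts G" "v \<in> verts G" "u \<noteq> v"
proof -
  have "{u, v} \<subseteq> verts G \<and> card {u, v} = 2"
    using assms unfolding simple_graph_def by blast
  then show "u \<in> verts G" "v \<in> verts G" "u \<noteq> v" by auto
qed

lemma edge_finite_nonempty:
  assumes "simple_graph G" "e \<in> edges G"
  shows "finite e" "e \<noteq> {}"
  using assms unfolding simple_graph_def by (auto dest!: subsetD[of "edges G"] simp: card_2_iff)

lemma edge_obtain:
  assumes "simple_graph G" "e \<in> edges G"
  obtains u v where "e = {u, v}" "u \<noteq> v"
  using assms unfolding simple_graph_def by (auto dest!: subsetD[of "edges G"] simp: card_2_iff)

lemma edge_obtain_at:
  assumes "simple_graph G" "e \<in> edges G" "u \<in> e"
  obtains v where "e = {u, v}"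
proof -
  obtain x y where "e = {x, y}" using edge_obtain[OF assms(1,2)] .
  then have "e = {u, x} \<or> e = {u, y}" using assms(3) by auto
  then show thesis using that by blast
qed

lemma edge_subset:
  assumes "simple_graph G" "e \<in> edges G"
  shows "e \<subseteq> verts G"
  using assms unfolding simple_graph_def by auto

lemma vertex_dist_self_le:
  assumes "u \<in> verts G"
  shows "vertex_dist G u u \<le> 0"
proof -
  have "[u] \<in> paths_between G u u"
    using assms by (simp add: paths_between_def)
  then have "vertex_dist G u u \<le> enat (length [u] - 1)"
    unfolding vertex_dist_def by (rule INF_lower)
  then show ?thesis
    by (simp add: zero_enat_def)
qed

lemma vertex_dist_adjacent_le:
  assumes "simple_graph G" "{u, v} \<in> edges G"
  shows "vertex_dist G u v \<le> 1"
proof -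
  have "[u, v] \<in> paths_between G u v"
    using assms edgeD[OF assms] by (simp add: paths_between_def)
  then have "vertex_dist G u v \<le> enat (length [u, v] - 1)"
    unfolding vertex_dist_def by (rule INF_lower)
  then show ?thesis
    by (simp add: one_enat_def)
qed

lemma vertex_dist_ge_1:
  assumes "u \<noteq> v"
  shows "1 \<le> vertex_dist G u v"
  unfolding vertex_dist_def
proof (rule INF_greatest)
  fix p assume "p \<in> paths_between G u v"
  then have p: "p \<noteq> []" "hd p = u" "last p = v"
    by (auto simp: paths_between_def)
  with assms have "1 \<le> length p - 1"
    by (cases p; cases "tl p") auto
  then show "1 \<le> enat (length p - 1)"
    by (simp add: one_enat_def)
qed

lemma vertex_dist_ge_2:
  assumes "u \<noteq> v" "{u, v} \<notin> edges G"
  shows "2 \<le> vertex_dist G u v"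
  unfolding vertex_dist_def
proof (rule INF_greatest)
  fix p assume "p \<in> paths_between G u v"
  then have p: "p \<noteq> []" "hd p = u" "last p = v" "successively (\<lambda>x y. {x, y} \<in> edges G) p"
    by (auto simp: paths_between_def)
  with assms have "2 \<le> length p - 1"
    by (cases p; cases "tl p"; cases "tl (tl p)") auto
  then show "2 \<le> enat (length p - 1)"
    by (simp add: numeral_eq_enat)
qed

text \<open>Two distinct elements touch exactly if their distance is 1. Since all \<open>a i\<close> are positive, they
  get different colors in every packing total coloring, and where \<open>a i = 1\<close> no other pair of
  elements is constrained.\<close>

fun touching :: "'a ugraph \<Rightarrow> 'a + 'a set \<Rightarrow> 'a + 'a set \<Rightarrow> bool" where
  "touching G (Inl u) (Inl v) \<longleftrightarrow> {u, v} \<in> edges G"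
| "touching G (Inl u) (Inr e) \<longleftrightarrow> u \<in> e"
| "touching G (Inr e) (Inl u) \<longleftrightarrow> u \<in> e"
| "touching G (Inr e) (Inr f) \<longleftrightarrow> e \<inter> f \<noteq> {}"

lemma elem_dist_vertex_edge_le:
  assumes "simple_graph G" "e \<in> edges G" "v \<in> e"
  shows "elem_dist G (Inl u) (Inr e) \<le> vertex_dist G u v + 1"
  using edge_finite_nonempty[OF assms(1,2)] assms(3) by (auto intro!: add_right_mono Min_le)

lemma elem_dist_touching_le:
  assumes G: "simple_graph G" and AB: "A \<in> verts G <+> edges G" "B \<in> verts G <+> edges G"
    and t: "touching G A B"
  shows "elem_dist G A B \<le> 1"
proof -
  have self: "vertex_dist G w w + 1 \<le> 1" if "w \<in> verts G" for w
    using vertex_dist_self_le[OF that] by simp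
  consider u v where "A = Inl u" "B = Inl v" | u e where "A = Inl u" "B = Inr e"
    | u e where "A = Inr e" "B = Inl u" | e f where "A = Inr e" "B = Inr f"
    by (cases A; cases B) auto
  then show ?thesis
  proof cases
    case 1
    then show ?thesis using t vertex_dist_adjacent_le[OF G] by simp
  next
    case 2
    then have "u \<in> verts G" "e \<in> edges G" "u \<in> e" using AB t by auto
    then show ?thesis
      using 2 elem_dist_vertex_edge_le[OF G, of e u u] self[of u] by (metis order_trans)
  next
    case 3
    then have "u \<in> verts G" "e \<in> edges G" "u \<in> e" using AB t by auto
    then show ?thesis
      using 3 elem_dist_vertex_edge_le[OF G, of e u u] self[of u] by (auto intro: order_trans)
  next
    case 4
    then have ef: "e \<in> edges G" "f \<in> edges G" using AB by auto
    obtain w where w: "w \<in> e" "w \<in> f" using t 4 by auto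
    have "(MIN (x, y) \<in> e \<times> f. vertex_dist G x y) \<le> vertex_dist G w w"
      using w edge_finite_nonempty[OF G ef(1)] edge_finite_nonempty[OF G ef(2)]
      by (intro Min_le) (auto intro!: image_eqI[of _ _ "(w, w)"])
    moreover have "w \<in> verts G" using w ef edge_subset[OF G] by auto
    ultimately show ?thesis
      using 4 self[of w] add_right_mono[of _ "vertex_dist G w w" 1] by (auto intro: order_trans)
  qed
qed

lemma elem_dist_not_touching_gt:
  assumes G: "simple_graph G" and AB: "A \<in> verts G <+> edges G" "B \<in> verts G <+> edges G"
    and t: "A \<noteq> B" "\<not> touching G A B"
  shows "elem_dist G A B > enat 1"
proof -
  have gt: "enat 1 < d" if "2 \<le> d" for d :: enat
    using that by (rule less_le_trans[rotated]) (simp add: numeral_eq_enat)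
  have gt': "enat 1 < d + 1" if "1 \<le> d" for d :: enat
    using gt[of "d + 1"] add_right_mono[OF that, of 1] by simp
  have min: "enat 1 < (MIN x \<in> e. vertex_dist G u x) + 1" if "e \<in> edges G" "u \<notin> e" for u e
    using that edge_finite_nonempty[OF G, of e]
    by (intro gt' Min.boundedI) (auto intro!: vertex_dist_ge_1)
  consider u v where "A = Inl u" "B = Inl v" | u e where "A = Inl u" "B = Inr e"
    | u e where "A = Inr e" "B = Inl u" | e f where "A = Inr e" "B = Inr f"
    by (cases A; cases B) auto
  then show ?thesis
  proof cases
    case 1
    then show ?thesis using t gt vertex_dist_ge_2[of u v G] by simp
  next
    case 2
    then show ?thesis using AB t min by auto
  next
    case 3
    then show ?thesis using AB t min by auto
  next
    case 4
    then have "e \<in> edges G" "f \<in> edges G" "e \<inter> f = {}" using AB t by auto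
    then have "enat 1 < (MIN (x, y) \<in> e \<times> f. vertex_dist G x y) + 1"
      using edge_finite_nonempty[OF G, of e] edge_finite_nonempty[OF G, of f]
      by (intro gt' Min.boundedI) (auto intro!: vertex_dist_ge_1)
    then show ?thesis using 4 by simp
  qed
qed

section \<open>Three colors on the closed neighborhoods\<close>

lemma touching_colors_differ:
  assumes "simple_graph G" "packing_total_coloring a G k c" "\<And>i. 1 \<le> i \<Longrightarrow> 0 < a i"
    and "A \<in> verts G <+> edges G" "B \<in> verts G <+> edges G" "A \<noteq> B" "touching G A B"
  shows "c A \<noteq> c B"
proof
  assume eq: "c A = c B"
  have "c A \<in> {1..k}"
    using assms(2,4) unfolding packing_total_coloring_def by blast
  then have "enat 1 \<le> enat (a (c A))"
    using assms(3)[of "c A"] by simp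
  moreover have "enat (a (c A)) < elem_dist G A B"
    using assms(2,4,5,6) eq unfolding packing_total_coloring_def by blast
  ultimately show False
    using elem_dist_touching_le[OF assms(1,4,5,7)] by (metis leD le_less_trans one_enat_def)
qed

lemma color_range:
  assumes "packing_total_coloring a G k c" "A \<in> verts G <+> edges G"
  shows "c A \<in> {1..k}"
  using assms unfolding packing_total_coloring_def by blast

lemma edge_colors_distinct:
  assumes "simple_graph G" "packing_total_coloring a G k c" "\<And>i. 1 \<le> i \<Longrightarrow> 0 < a i"
    and "{u, v} \<in> edges G"
  shows "c (Inl u) \<noteq> c (Inl v)" "c (Inl u) \<noteq> c (Inr {u, v})" "c (Inl v) \<noteq> c (Inr {u, v})"
    and "c (Inl u) \<in> {1..k}" "c (Inl v) \<in> {1..k}" "c (Inr {u, v}) \<in> {1..k}"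
proof -
  have el: "Inl u \<in> verts G <+> edges G" "Inl v \<in> verts G <+> edges G"
    "Inr {u, v} \<in> verts G <+> edges G" "u \<noteq> v"
    using assms(4) edgeD[OF assms(1,4)] by auto
  note differ = touching_colors_differ[OF assms(1,2,3)]
  show "c (Inl u) \<noteq> c (Inl v)" "c (Inl u) \<noteq> c (Inr {u, v})" "c (Inl v) \<noteq> c (Inr {u, v})"
    using differ[OF _ el(1,2)] differ[OF _ el(1,3)] differ[OF _ el(2,3)] el(4) assms(4) by simp_all
  show "c (Inl u) \<in> {1..k}" "c (Inl v) \<in> {1..k}" "c (Inr {u, v}) \<in> {1..k}"
    using color_range[OF assms(2)] el by blast+
qed

lemma third_color_unique:
  fixes x y z w :: nat
  assumes "x \<in> {1..3}" "y \<in> {1..3}" "z \<in> {1..3}" "w \<in> {1..3}"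
    and "x \<noteq> y" "z \<noteq> x" "z \<noteq> y" "w \<noteq> x" "w \<noteq> y"
  shows "z = w"
proof -
  have "t = 1 \<or> t = 2 \<or> t = 3" if "t \<in> {1..3}" for t :: nat
    using that by auto
  from this[OF assms(1)] this[OF assms(2)] this[OF assms(3)] this[OF assms(4)] assms(5-)
  show ?thesis by (elim disjE) simp_all
qed

text \<open>Both edges at \<open>v\<close> and their outer ends avoid the color of \<open>v\<close>, which leaves two colors for
  these four elements. The two edges differ, and each outer end differs from its own edge, so it
  agrees with the other edge.\<close>

lemma three_colors_on_cherry:
  assumes "simple_graph G" "packing_total_coloring a G 3 c" "\<And>i. 1 \<le> i \<Longrightarrow> 0 < a i"
    and uv: "{u, v} \<in> edges G" and vw: "{v, w} \<in> edges G" and "u \<noteq> w"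
  shows "c (Inl u) \<noteq> c (Inl w)" "c (Inr {v, w}) = c (Inl u)" "c (Inr {u, v}) = c (Inl w)"
proof -
  have "c (Inr {u, v}) \<noteq> c (Inr {v, w})"
    using assms(4-6) by (intro touching_colors_differ[OF assms(1,2,3)]) (auto simp: doubleton_eq_iff)
  note facts = this edge_colors_distinct[OF assms(1,2,3) uv]
    edge_colors_distinct[OF assms(1,2,3) vw]
  show vw_u: "c (Inr {v, w}) = c (Inl u)"
    using facts by (intro third_color_unique[of "c (Inl v)" "c (Inr {u, v})"]) metis+
  show "c (Inr {u, v}) = c (Inl w)"
    using facts by (intro third_color_unique[of "c (Inl v)" "c (Inr {v, w})"]) metis+
  show "c (Inl u) \<noteq> c (Inl w)"
    using facts vw_u by metis
qed

text \<open>The colors of \<open>x\<close> and three neighbors would be four different colors.\<close>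

lemma at_most_two_neighbors:
  assumes G: "simple_graph G" "packing_total_coloring a G 3 c" "\<And>i. 1 \<le> i \<Longrightarrow> 0 < a i"
    and e: "{x, u} \<in> edges G" "{x, v} \<in> edges G" "{x, w} \<in> edges G"
  shows "u = v \<or> u = w \<or> v = w"
proof (rule ccontr)
  assume "\<not> ?thesis"
  then have "c (Inl u) \<noteq> c (Inl v)" "c (Inl u) \<noteq> c (Inl w)" "c (Inl v) \<noteq> c (Inl w)"
    using three_colors_on_cherry(1)[OF G, of u x] three_colors_on_cherry(1)[OF G, of v x] e
    by (auto simp: insert_commute)
  with edge_colors_distinct[OF G e(1)] edge_colors_distinct[OF G e(2)]
    edge_colors_distinct[OF G e(3)]
  show False
    using third_color_unique[of "c (Inl x)" "c (Inl u)" "c (Inl v)" "c (Inl w)"] by metis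
qed

text \<open>A vertex labelling that is injective modulo 3 on closed neighborhoods extends to the edges
  by addition: the labels of two elements that meet in a vertex \<open>u\<close> have the form \<open>h u + h x\<close>
  and \<open>h u + h y\<close> with \<open>x \<noteq> y\<close> in the closed neighborhood of \<open>u\<close>, or are \<open>2 * h u\<close> and
  \<open>2 * h v\<close> for adjacent vertices. If \<open>h\<close> numbers the vertices along a path, this labels the
  vertices and edges \<open>0, 1, 2, \<dots>\<close> in the order in which they lie on the path.\<close>

definition total_label :: "('a \<Rightarrow> nat) \<Rightarrow> 'a + 'a set \<Rightarrow> nat" where
  "total_label h = case_sum (\<lambda>u. 2 * h u) (sum h)"

lemma total_label_simps [simp]:
  "total_label h (Inl u) = 2 * h u"
  "u \<noteq> v \<Longrightarrow> total_label h (Inr {u, v}) = h u + h v"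
  by (simp_all add: total_label_def)

lemma add_left_mod_3_cancel:
  fixes x y z :: nat
  shows "(x + y) mod 3 = (x + z) mod 3 \<longleftrightarrow> y mod 3 = z mod 3"
  by (induction x) (auto simp: mod_Suc split: if_splits)

lemma double_mod_3_cancel:
  fixes x y :: nat
  shows "2 * x mod 3 = 2 * y mod 3 \<longleftrightarrow> x mod 3 = y mod 3"
proof -
  \<comment> \<open>Modulo 3, doubling is its own inverse.\<close>
  have "2 * (2 * z mod 3) mod 3 = z mod 3" for z :: nat
  proof -
    have "2 * (2 * z mod 3) mod 3 = (z + z * 3) mod 3" by (simp add: mod_mult_right_eq)
    then show ?thesis by (simp only: mod_mult_self1)
  qed
  then show ?thesis by (metis mod_mult_right_eq)
qed

lemma add_mod_3_neq:
  fixes x :: nat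
  shows "(x + 1) mod 3 \<noteq> x mod 3" "(x + 2) mod 3 \<noteq> x mod 3"
  by (simp_all add: mod_Suc)

lemma add_2_mod_3:
  fixes x y z :: nat
  assumes "x mod 3 = (y + 1) mod 3" "y mod 3 = (z + 1) mod 3"
  shows "x mod 3 = (z + 2) mod 3"
  using assms mod_Suc_eq[of y 3] mod_Suc_eq[of "z + 1" 3] by simp

lemma total_label_touching:
  assumes G: "simple_graph G"
    and adj: "\<And>u v. {u, v} \<in> edges G \<Longrightarrow> h u mod 3 \<noteq> h v mod 3"
    and nbr: "\<And>u v w. {u, v} \<in> edges G \<Longrightarrow> {u, w} \<in> edges G \<Longrightarrow> v \<noteq> w \<Longrightarrow> h v mod 3 \<noteq> h w mod 3"
    and AB: "A \<in> verts G <+> edges G" "B \<in> verts G <+> edges G" "A \<noteq> B" "touching G A B"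
  shows "total_label h A mod 3 \<noteq> total_label h B mod 3"
proof -
  have ve: "2 * h u mod 3 \<noteq> sum h e mod 3" if e: "e \<in> edges G" "u \<in> e" for u e
  proof -
    obtain v where v: "e = {u, v}" using edge_obtain_at[OF G e] .
    then have "h u mod 3 \<noteq> h v mod 3" "u \<noteq> v"
      using adj e edgeD(3)[OF G] by auto
    then show ?thesis
      using v add_left_mod_3_cancel[of "h u" "h u" "h v"] by (simp add: mult_2)
  qed
  consider u v where "A = Inl u" "B = Inl v" | u e where "A = Inl u" "B = Inr e"
    | u e where "A = Inr e" "B = Inl u" | e f where "A = Inr e" "B = Inr f"
    by (cases A; cases B) auto
  then show ?thesis
  proof cases
    case 1
    then have "h u mod 3 \<noteq> h v mod 3" using AB adj by auto
    then show ?thesis using 1 by (simp add: double_mod_3_cancel)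
  next
    case 2
    then show ?thesis using AB ve by (auto simp: total_label_def)
  next
    case 3
    then show ?thesis using AB ve[of e u] by (auto simp: total_label_def)
  next
    case 4
    then obtain u where ef: "e \<in> edges G" "f \<in> edges G" "u \<in> e" "u \<in> f" "e \<noteq> f"
      using AB by auto
    obtain v w where v: "e = {u, v}" and w: "f = {u, w}"
      using edge_obtain_at[OF G ef(1,3)] edge_obtain_at[OF G ef(2,4)] by metis
    have "h v mod 3 \<noteq> h w mod 3"
      using nbr[of u v w] ef v w by auto
    moreover have "u \<noteq> v" "u \<noteq> w"
      using ef v w edgeD(3)[OF G] by auto
    ultimately show ?thesis using 4 v w add_left_mod_3_cancel[of "h u" "h v" "h w"] by simp
  qed
qed

lemma packing_total_coloring_of_labelling:
  assumes G: "simple_graph G"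
    and adj: "\<And>u v. {u, v} \<in> edges G \<Longrightarrow> h u mod 3 \<noteq> h v mod 3"
    and nbr: "\<And>u v w. {u, v} \<in> edges G \<Longrightarrow> {u, w} \<in> edges G \<Longrightarrow> v \<noteq> w \<Longrightarrow> h v mod 3 \<noteq> h w mod 3"
    and one: "\<And>A B. A \<in> verts G <+> edges G \<Longrightarrow> B \<in> verts G <+> edges G \<Longrightarrow> A \<noteq> B \<Longrightarrow>
      total_label h A mod 3 = total_label h B mod 3 \<Longrightarrow> a (1 + total_label h A mod 3) = 1"
  shows "packing_total_coloring a G 3 (\<lambda>A. 1 + total_label h A mod 3)"
  unfolding packing_total_coloring_def
proof (intro conjI ballI impI)
  show "(\<lambda>A. 1 + total_label h A mod 3) \<in> verts G <+> edges G \<rightarrow> {1..3}"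
    by (auto simp: Suc_le_eq)
next
  fix A B assume AB: "A \<in> verts G <+> edges G" "B \<in> verts G <+> edges G" "A \<noteq> B"
    and eq: "1 + total_label h A mod 3 = 1 + total_label h B mod 3"
  then have "\<not> touching G A B"
    using total_label_touching[of G h A B] G adj nbr by auto
  then have "enat 1 < elem_dist G A B"
    using elem_dist_not_touching_gt G AB by blast
  with one[of A B] AB eq show "enat (a (1 + total_label h A mod 3)) < elem_dist G A B"
    by simp
qed

section \<open>The total chromatic number 3\<close>

lemma packing_total_coloring_exists:
  assumes G: "simple_graph G"
  shows "\<exists>k c. packing_total_coloring a G k c"
proof -
  have "edges G \<subseteq> Pow (verts G)" using G by (auto simp: simple_graph_def)
  then have "finite (verts G <+> edges G)"
    using G by (auto simp: simple_graph_def intro: finite_subset)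
  then obtain c where "bij_betw c (verts G <+> edges G) {1..card (verts G <+> edges G)}"
    using finite_same_card_bij[of "verts G <+> edges G" "{1..card (verts G <+> edges G)}"] by auto
  then have "packing_total_coloring a G (card (verts G <+> edges G)) c"
    unfolding packing_total_coloring_def bij_betw_def inj_on_def by fast
  then show ?thesis by blast
qed

text \<open>An edge and its two ends need three colors. Without edges a connected graph is a single
  vertex, for which one color is enough.\<close>

lemma chromatic_number_3_iff:
  assumes G: "simple_graph G" "connected_graph G" and pos: "\<And>i. 1 \<le> i \<Longrightarrow> 0 < a i"
  shows "packing_total_chromatic_number a G = 3 \<longleftrightarrow>
    edges G \<noteq> {} \<and> (\<exists>c. packing_total_coloring a G 3 c)"
proof
  assume 3: "packing_total_chromatic_number a G = 3"
  have "\<exists>c. packing_total_coloring a G (packing_total_chromatic_number a G) c"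
    unfolding packing_total_chromatic_number_def
    using packing_total_coloring_exists[OF G(1), of a] by (rule LeastI_ex)
  moreover have "edges G \<noteq> {}"
  proof
    assume E: "edges G = {}"
    have "u = v" if uv: "u \<in> verts G" "v \<in> verts G" for u v
    proof (rule ccontr)
      assume "u \<noteq> v"
      obtain p where "p \<in> paths_between G u v"
        using uv G(2) by (auto simp: connected_graph_def)
      with E \<open>u \<noteq> v\<close> show False
        by (cases p; cases "tl p") (auto simp: paths_between_def)
    qed
    then have "packing_total_coloring a G 1 (\<lambda>_. 1)"
      unfolding packing_total_coloring_def using E by auto
    then have "packing_total_chromatic_number a G \<le> 1"
      unfolding packing_total_chromatic_number_def by (blast intro: Least_le)
    with 3 show False by simp
  qed
  ultimately show "edges G \<noteq> {} \<and> (\<exists>c. packing_total_coloring a G 3 c)"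
    using 3 by simp
next
  assume R: "edges G \<noteq> {} \<and> (\<exists>c. packing_total_coloring a G 3 c)"
  then obtain u v where uv: "{u, v} \<in> edges G"
    using edge_obtain[OF G(1)] by (metis ex_in_conv)
  have "3 \<le> k" if col: "\<exists>c. packing_total_coloring a G k c" for k
  proof -
    obtain c where "packing_total_coloring a G k c" using col by blast
    from edge_colors_distinct[OF G(1) this pos uv] show ?thesis
      by auto
  qed
  then show "packing_total_chromatic_number a G = 3"
    unfolding packing_total_chromatic_number_def using R by (intro Least_equality) auto
qed

section \<open>Connected graphs of maximum degree 2\<close>

lemma graph_iso_sym:
  assumes "graph_iso G H"
  shows "graph_iso H G"
proof -
  obtain f where f: "bij_betw f (verts G) (verts H)"
    and e: "\<And>u v. u \<in> verts G \<Longrightarrow> v \<in> verts G \<Longrightarrow> {u, v} \<in> edges G \<longleftrightarrow> {f u, f v} \<in> edges H"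
    using assms unfolding graph_iso_def by blast
  let ?g = "inv_into (verts G) f"
  have "bij_betw ?g (verts H) (verts G)"
    using f by (rule bij_betw_inv_into)
  moreover have "{u, v} \<in> edges H \<longleftrightarrow> {?g u, ?g v} \<in> edges G" if "u \<in> verts H" "v \<in> verts H" for u v
    using e[of "?g u" "?g v"] that f
    by (simp add: bij_betw_inv_into_right[OF f] bij_betw_imp_surj_on inv_into_into)
  ultimately show ?thesis unfolding graph_iso_def by blast
qed

lemma path_graph_edge_iff:
  "{i, j} \<in> edges (path_graph n) \<longleftrightarrow> i < n \<and> j < n \<and> (j = i + 1 \<or> i = j + 1)"
  by (auto simp: path_graph_def doubleton_eq_iff)

lemma cycle_graph_edge_iff:
  "{i, j} \<in> edges (cycle_graph n) \<longleftrightarrow>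
    i < n \<and> j < n \<and> (j = (i + 1) mod n \<or> i = (j + 1) mod n)"
  by (auto simp: cycle_graph_def doubleton_eq_iff)

lemma connected_closed_set:
  assumes G: "connected_graph G" and S: "s \<in> S" "s \<in> verts G"
    and closed: "\<And>x y. x \<in> S \<Longrightarrow> {x, y} \<in> edges G \<Longrightarrow> y \<in> S"
  shows "verts G \<subseteq> S"
proof
  fix v assume "v \<in> verts G"
  then obtain p where "p \<in> paths_between G s v"
    using G S by (auto simp: connected_graph_def)
  then have p: "p \<noteq> []" "hd p = s" "last p = v" "successively (\<lambda>x y. {x, y} \<in> edges G) p"
    by (auto simp: paths_between_def)
  have "set q \<subseteq> S" if "q \<noteq> []" "hd q \<in> S" "successively (\<lambda>x y. {x, y} \<in> edges G) q" for q
    using that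
  proof (induction q rule: induct_list012)
    case (3 x y zs)
    then have "y \<in> S" using closed[of x y] by simp
    with 3 show ?case by simp
  qed auto
  then show "v \<in> S"
    using p S last_in_set[of p] by blast
qed

text \<open>In a longest path no vertex has a neighbor outside the path: an end could be used to prolong
  it, and an inner vertex already has its two neighbors on it. By connectedness the path visits
  every vertex, and the only further edge that the degrees allow joins its two ends.\<close>

lemma path_or_cycle:
  assumes G: "simple_graph G" "connected_graph G"
    and deg: "\<And>x u v w. {x, u} \<in> edges G \<Longrightarrow> {x, v} \<in> edges G \<Longrightarrow> {x, w} \<in> edges G \<Longrightarrow>
      u = v \<or> u = w \<or> v = w"
  shows "(\<exists>n. graph_iso G (path_graph n)) \<or> (\<exists>n\<ge>3. graph_iso G (cycle_graph n))"
proof -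
  define P where "P p \<longleftrightarrow> p \<noteq> [] \<and> distinct p \<and> set p \<subseteq> verts G \<and>
    successively (\<lambda>x y. {x, y} \<in> edges G) p" for p
  have fin: "finite (verts G)" using G by (simp add: simple_graph_def)
  obtain s where "s \<in> verts G" using G(2) by (auto simp: connected_graph_def)
  then have "P [s]" by (simp add: P_def)
  moreover have "\<forall>p. P p \<longrightarrow> length p \<le> card (verts G)"
    by (auto simp: P_def distinct_card[symmetric] intro: card_mono[OF fin])
  ultimately obtain p where p: "P p" and longest: "\<And>q. P q \<Longrightarrow> length q \<le> length p"
    using ex_has_greatest_nat[of P "[s]" length "card (verts G) + 1"] by (metis less_Suc_eq_le Suc_eq_plus1)
  define m where "m = length p"
  have ne: "p \<noteq> []" and dis: "distinct p" and sub: "set p \<subseteq> verts G"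
    and succ: "successively (\<lambda>x y. {x, y} \<in> edges G) p"
    using p by (auto simp: P_def)
  have step: "{p ! i, p ! (i + 1)} \<in> edges G" if "i + 1 < m" for i
    using succ that unfolding successively_conv_nth m_def by simp
  have nth_eq: "p ! i = p ! j \<longleftrightarrow> i = j" if "i < m" "j < m" for i j
    using dis that by (simp add: nth_eq_iff_index_eq m_def)
  have inner: "w = p ! (i - 1) \<or> w = p ! (i + 1)"
    if "0 < i" "i + 1 < m" "{p ! i, w} \<in> edges G" for i w
  proof -
    have "{p ! i, p ! (i - 1)} \<in> edges G" "{p ! i, p ! (i + 1)} \<in> edges G"
      using step[of "i - 1"] step[of i] that by (auto simp: insert_commute)
    moreover have "p ! (i - 1) \<noteq> p ! (i + 1)"
      using nth_eq[of "i - 1" "i + 1"] that by simp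
    ultimately show ?thesis using deg that(3) by metis
  qed
  have closed: "y \<in> set p" if x: "x \<in> set p" and xy: "{x, y} \<in> edges G" for x y
  proof (rule ccontr)
    assume y: "y \<notin> set p"
    have yV: "y \<in> verts G" using edgeD[OF G(1) xy] by simp
    obtain i where i: "x = p ! i" "i < m"
      using x by (auto simp: in_set_conv_nth m_def)
    consider "i = 0" | "i + 1 = m" | "0 < i" "i + 1 < m" using i by linarith
    then show False
    proof cases
      case 1
      then have "P (y # p)"
        using p y yV xy i by (auto simp: P_def successively_Cons hd_conv_nth insert_commute)
      then show False using longest by fastforce
    next
      case 2
      then have "x = last p" using i ne by (simp add: last_conv_nth m_def[symmetric] flip: 2)
      then have "P (p @ [y])"
        using p y yV xy by (auto simp: P_def successively_append_iff)
      then show False using longest by fastforce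
    next
      case 3
      then have "y = p ! (i - 1) \<or> y = p ! (i + 1)" using inner xy i by simp
      then show False using y 3 by (auto simp: m_def)
    qed
  qed
  have "verts G \<subseteq> set p"
    using connected_closed_set[OF G(2), of "hd p" "set p"] closed ne sub hd_in_set[of p] by blast
  with sub have V: "set p = verts G" by blast
  have bij: "bij_betw ((!) p) {..<m} (verts G)"
    using bij_betw_nth[OF dis, of "{..<m}" "set p"] V by (simp add: m_def)
  have skip: "j = i + 1 \<or> i = 0 \<and> j = m - 1"
    if ij: "i < j" "j < m" and e: "{p ! i, p ! j} \<in> edges G" for i j
  proof -
    consider "0 < i" | "i = 0" "j + 1 < m" | "i = 0" "j = m - 1" using ij by linarith
    then show ?thesis
    proof cases
      case 1
      then show ?thesis using inner[of i "p ! j"] nth_eq[of j] ij e by auto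
    next
      case 2
      then show ?thesis
        using inner[of j "p ! i"] nth_eq[of i] ij e by (auto simp: insert_commute)
    qed auto
  qed
  have no_loop: "{p ! i, p ! i} \<notin> edges G" for i using edgeD(3)[OF G(1)] by blast
  have from_less: "{i, j} \<in> edges H \<longleftrightarrow> {p ! i, p ! j} \<in> edges G"
    if less: "\<And>i j. i < j \<Longrightarrow> j < m \<Longrightarrow> {i, j} \<in> edges H \<longleftrightarrow> {p ! i, p ! j} \<in> edges G"
      and "\<And>i. {i, i} \<notin> edges H" and "i < m" "j < m" for H :: "nat ugraph" and i j
  proof (cases i j rule: linorder_cases)
    case greater
    then have "{j, i} \<in> edges H \<longleftrightarrow> {p ! j, p ! i} \<in> edges G" using less that(3) by blast
    then show ?thesis by (simp only: insert_commute)
  qed (use that(2-4) less no_loop in simp_all)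
  show ?thesis
  proof (cases "3 \<le> m \<and> {p ! 0, p ! (m - 1)} \<in> edges G")
    case True
    have "{i, j} \<in> edges (cycle_graph m) \<longleftrightarrow> {p ! i, p ! j} \<in> edges G"
      if "i < j" "j < m" for i j
      using skip[of i j] step[of i] that True
      by (auto simp: cycle_graph_edge_iff mod_Suc insert_commute)
    moreover have "{i, i} \<notin> edges (cycle_graph m)" for i
      using True by (auto simp only: cycle_graph_edge_iff) (auto simp: mod_Suc split: if_splits)
    ultimately have "{i, j} \<in> edges (cycle_graph m) \<longleftrightarrow> {p ! i, p ! j} \<in> edges G"
      if "i < m" "j < m" for i j
      using that by (rule from_less)
    then have "graph_iso (cycle_graph m) G"
      unfolding graph_iso_def using bij by (auto simp: cycle_graph_def)
    then show ?thesis using graph_iso_sym True by blast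
  next
    case False
    have "{i, j} \<in> edges (path_graph m) \<longleftrightarrow> {p ! i, p ! j} \<in> edges G"
      if "i < j" "j < m" for i j
      using skip[of i j] step[of i] that False
      by (cases "j = i + 1") (auto simp: path_graph_edge_iff)
    moreover have "{i, i} \<notin> edges (path_graph m)" for i
      by (simp only: path_graph_edge_iff) simp
    ultimately have "{i, j} \<in> edges (path_graph m) \<longleftrightarrow> {p ! i, p ! j} \<in> edges G"
      if "i < m" "j < m" for i j
      using that by (rule from_less)
    then have "graph_iso (path_graph m) G"
      unfolding graph_iso_def using bij by (auto simp: path_graph_def)
    then show ?thesis using graph_iso_sym by blast
  qed
qed


section \<open>Coloring paths and cycles\<close>

text \<open>The labels along the path are \<open>0, \<dots>, 2 * (n - 1)\<close>, each used once. Hence for \<open>n \<le> 2\<close> no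
  color is repeated, and for \<open>n \<le> 3\<close> only the colors 1 and 2 are.\<close>

lemma path_packing_total_coloring:
  assumes G: "simple_graph G" and pos: "\<And>i. 1 \<le> i \<Longrightarrow> 0 < a i"
    and mono: "\<And>i j. 1 \<le> i \<Longrightarrow> i \<le> j \<Longrightarrow> a i \<le> a j"
    and iso: "graph_iso G (path_graph n)"
    and n: "a 3 = 1 \<or> a 2 = 1 \<and> n \<le> 3 \<or> n \<le> 2"
  shows "\<exists>c. packing_total_coloring a G 3 c"
proof -
  obtain f where f: "bij_betw f (verts G) {..<n}"
    and e: "\<And>u v. u \<in> verts G \<Longrightarrow> v \<in> verts G \<Longrightarrow>
      {u, v} \<in> edges G \<longleftrightarrow> {f u, f v} \<in> edges (path_graph n)"
    using iso unfolding graph_iso_def by (auto simp: path_graph_def)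
  have lt: "f u < n" if "u \<in> verts G" for u
    using f that by (auto simp: bij_betw_def)
  have inj: "u = v" if "f u = f v" "u \<in> verts G" "v \<in> verts G" for u v
    using f that by (auto simp: bij_betw_def inj_on_def)
  have step: "f v = f u + 1 \<or> f u = f v + 1" if "{u, v} \<in> edges G" for u v
    using e[of u v] edgeD[OF G that] that by (auto simp: path_graph_edge_iff)
  have vertex: "2 * f u \<le> 2 * (n - 1)" if "u \<in> verts G" for u
    using lt[OF that] by simp
  have edge: "\<exists>u v. d = {u, v} \<and> u \<in> verts G \<and> v \<in> verts G \<and> f v = f u + 1 \<and>
      total_label f (Inr d) = 2 * f u + 1 \<and> 2 * f u + 1 \<le> 2 * (n - 1)" if d: "d \<in> edges G" for d
  proof -
    obtain x y where xy: "d = {x, y}" "x \<noteq> y" using edge_obtain[OF G d] .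
    then have *: "x \<in> verts G" "y \<in> verts G" using d edgeD[OF G] by auto
    from step[of x y] xy d have "f y = f x + 1 \<or> f x = f y + 1" by simp
    then show ?thesis
    proof
      assume "f y = f x + 1"
      then have "total_label f (Inr d) = 2 * f x + 1" "2 * f x + 1 \<le> 2 * (n - 1)"
        using xy lt[OF *(2)] by auto
      then show ?thesis using xy * \<open>f y = f x + 1\<close> by blast
    next
      assume "f x = f y + 1"
      then have "total_label f (Inr d) = 2 * f y + 1" "2 * f y + 1 \<le> 2 * (n - 1)"
        using xy lt[OF *(1)] by auto
      moreover have "d = {y, x}" using xy by (simp add: insert_commute)
      ultimately show ?thesis using * \<open>f x = f y + 1\<close> by blast
    qed
  qed
  have bound: "total_label f A \<le> 2 * (n - 1)" if "A \<in> verts G <+> edges G" for A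
    using that vertex edge by (cases A) fastforce+
  \<comment> \<open>Vertices have even labels and edges odd ones.\<close>
  have label_inj: "A = B"
    if AB: "A \<in> verts G <+> edges G" "B \<in> verts G <+> edges G"
      and eq: "total_label f A = total_label f B" for A B
  proof -
    have parity: "2 * f u \<noteq> total_label f (Inr d)" if d: "d \<in> edges G" for u d
    proof -
      obtain x where "total_label f (Inr d) = 2 * f x + 1" using edge[OF d] by blast
      then show ?thesis by presburger
    qed
    consider u v where "A = Inl u" "B = Inl v" | u d where "A = Inl u" "B = Inr d"
      | u d where "A = Inr d" "B = Inl u" | d d' where "A = Inr d" "B = Inr d'"
      by (cases A; cases B) auto
    then show ?thesis
    proof cases
      case 1
      then show ?thesis using AB eq inj by auto
    next
      case 2
      then show ?thesis using AB eq parity[of d u] by auto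
    next
      case 3
      then show ?thesis using AB eq parity[of d u] by auto
    next
      case 4
      then have d: "d \<in> edges G" "d' \<in> edges G" using AB by auto
      obtain u v where 1: "d = {u, v}" "u \<in> verts G" "v \<in> verts G" "f v = f u + 1"
        "total_label f (Inr d) = 2 * f u + 1" using edge[OF d(1)] by blast
      obtain x y where 2: "d' = {x, y}" "x \<in> verts G" "y \<in> verts G" "f y = f x + 1"
        "total_label f (Inr d') = 2 * f x + 1" using edge[OF d(2)] by blast
      have "f u = f x" using 1 2 eq 4 by simp
      moreover from this have "f v = f y" using 1 2 by simp
      ultimately show ?thesis using inj[of u x] inj[of v y] 1 2 4 by simp
    qed
  qed
  have adj: "f u mod 3 \<noteq> f v mod 3" if "{u, v} \<in> edges G" for u v
    using step[OF that] add_mod_3_neq(1) by metis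
  have nbr: "f v mod 3 \<noteq> f w mod 3" if "{u, v} \<in> edges G" "{u, w} \<in> edges G" "v \<noteq> w" for u v w
  proof -
    have "f v \<noteq> f w" using inj that edgeD[OF G] by blast
    then have "f v = f w + 2 \<or> f w = f v + 2"
      using step[OF that(1)] step[OF that(2)] by linarith
    then show ?thesis using add_mod_3_neq(2) by metis
  qed
  have one: "a (1 + total_label f A mod 3) = 1"
    if AB: "A \<in> verts G <+> edges G" "B \<in> verts G <+> edges G" "A \<noteq> B"
      and eq: "total_label f A mod 3 = total_label f B mod 3" for A B
  proof -
    define x y where "x = total_label f A" and "y = total_label f B"
    have xy: "x \<noteq> y" "x mod 3 = y mod 3" "x \<le> 2 * (n - 1)" "y \<le> 2 * (n - 1)"
      using label_inj AB eq bound by (auto simp: x_def y_def)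
    have le1: "a (1 + x mod 3) = 1" if "a k = 1" "1 + x mod 3 \<le> k" for k
      using that pos[of "1 + x mod 3"] mono[of "1 + x mod 3" k] by simp
    from n consider "a 3 = 1" | "a 2 = 1" "n \<le> 3" | "n \<le> 2" by blast
    then have "a (1 + x mod 3) = 1"
    proof cases
      case 1
      have "1 + x mod 3 \<le> 3" by presburger
      then show ?thesis by (rule le1[OF 1])
    next
      \<comment> \<open>Among the labels \<open>0, \<dots>, 4\<close> the residue 2 occurs only once.\<close>
      case 2
      then have "x \<le> 4" "y \<le> 4" using xy by auto
      have "1 + x mod 3 \<le> 2"
      proof (rule ccontr)
        assume "\<not> ?thesis"
        then have "x mod 3 = 2" "y mod 3 = 2" using xy(2) by auto
        then have "x = 2" "y = 2" using \<open>x \<le> 4\<close> \<open>y \<le> 4\<close> by presburger+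
        then show False using xy(1) by simp
      qed
      then show ?thesis by (rule le1[OF 2(1)])
    next
      case 3
      then have "x \<le> 2" "y \<le> 2" using xy by auto
      then show ?thesis using xy by simp
    qed
    then show ?thesis by (simp add: x_def)
  qed
  show ?thesis
    by (rule exI, rule packing_total_coloring_of_labelling[OF G, of f])
      (fact adj, fact nbr, fact one)
qed

text \<open>As 3 divides \<open>n\<close>, the numbering of the vertices remains consecutive modulo 3 across the edge
  that closes the cycle.\<close>

lemma cycle_packing_total_coloring:
  assumes G: "simple_graph G" and pos: "\<And>i. 1 \<le> i \<Longrightarrow> 0 < a i"
    and mono: "\<And>i j. 1 \<le> i \<Longrightarrow> i \<le> j \<Longrightarrow> a i \<le> a j"
    and iso: "graph_iso G (cycle_graph n)" and n: "n mod 3 = 0" and "a 3 = 1"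
  shows "\<exists>c. packing_total_coloring a G 3 c"
proof -
  obtain f where f: "bij_betw f (verts G) {..<n}"
    and e: "\<And>u v. u \<in> verts G \<Longrightarrow> v \<in> verts G \<Longrightarrow>
      {u, v} \<in> edges G \<longleftrightarrow> {f u, f v} \<in> edges (cycle_graph n)"
    using iso unfolding graph_iso_def by (auto simp: cycle_graph_def)
  have lt: "f u < n" if "u \<in> verts G" for u
    using f that by (auto simp: bij_betw_def)
  have inj: "u = v" if "f u = f v" "u \<in> verts G" "v \<in> verts G" for u v
    using f that by (auto simp: bij_betw_def inj_on_def)
  have step: "f v = (f u + 1) mod n \<or> f u = (f v + 1) mod n" if "{u, v} \<in> edges G" for u v
    using e[of u v] edgeD[OF G that] that by (simp add: cycle_graph_edge_iff)
  have succ_mod3: "x mod 3 = (y + 1) mod 3" if "x = (y + 1) mod n" for x y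
    using that mod_mod_cancel[OF mod_0_imp_dvd[OF n], of "y + 1"] by simp
  have adj: "f u mod 3 \<noteq> f v mod 3" if "{u, v} \<in> edges G" for u v
  proof -
    have "f v mod 3 = (f u + 1) mod 3 \<or> f u mod 3 = (f v + 1) mod 3"
      using step[OF that] succ_mod3 by blast
    then show ?thesis using add_mod_3_neq(1) by metis
  qed
  have nbr: "f v mod 3 \<noteq> f w mod 3" if uv: "{u, v} \<in> edges G" and uw: "{u, w} \<in> edges G" and "v \<noteq> w"
    for u v w
  proof -
    have "f v \<noteq> f w" using inj that edgeD[OF G] by blast
    moreover have "f v < n" "f w < n" using lt edgeD[OF G] uv uw by blast+
    ultimately have "\<not> (f u = (f v + 1) mod n \<and> f u = (f w + 1) mod n)"
      by (auto simp: mod_Suc split: if_splits)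
    then have "f v = (f u + 1) mod n \<and> f u = (f w + 1) mod n \<or>
        f w = (f u + 1) mod n \<and> f u = (f v + 1) mod n"
      using step[OF uv] step[OF uw] \<open>f v \<noteq> f w\<close> by metis
    then have "f v mod 3 = (f u + 1) mod 3 \<and> f u mod 3 = (f w + 1) mod 3 \<or>
        f w mod 3 = (f u + 1) mod 3 \<and> f u mod 3 = (f v + 1) mod 3"
      using succ_mod3 by blast
    then have "f v mod 3 = (f w + 2) mod 3 \<or> f w mod 3 = (f v + 2) mod 3"
      using add_2_mod_3 by blast
    then show ?thesis using add_mod_3_neq(2) by metis
  qed
  have one: "a (1 + total_label f A mod 3) = 1" for A
  proof -
    have "1 + total_label f A mod 3 \<le> 3" by presburger
    then show ?thesis
      using \<open>a 3 = 1\<close> pos[of "1 + total_label f A mod 3"] mono[of "1 + total_label f A mod 3" 3]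
      by simp
  qed
  show ?thesis
    by (rule exI, rule packing_total_coloring_of_labelling[OF G, of f])
      (fact adj, fact nbr, rule one)
qed

text \<open>Three consecutive vertices of the cycle have three different colors, so the colors repeat
  with period 3 around the cycle.\<close>

lemma cycle_length_mod_3:
  fixes g :: "nat \<Rightarrow> 'a" and n :: nat
  assumes G: "simple_graph G" "packing_total_coloring a G 3 c" "\<And>i. 1 \<le> i \<Longrightarrow> 0 < a i"
    and g: "inj_on g {..<n}" "3 \<le> n" "\<And>i. i < n \<Longrightarrow> {g i, g ((i + 1) mod n)} \<in> edges G"
  shows "n mod 3 = 0"
proof -
  define k where "k i = c (Inl (g (i mod n)))" for i
  have edge: "{g (i mod n), g ((i + 1) mod n)} \<in> edges G" for i
    using g(3)[of "i mod n"] g(2) by (simp add: mod_Suc_eq)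
  have "i mod n \<noteq> (i + 2) mod n" for i
  proof
    assume "i mod n = (i + 2) mod n"
    then have "n dvd 2" using mod_eq_dvd_iff_nat[of i "i + 2" n] by (simp add: eq_commute)
    then show False using g(2) by (auto dest: dvd_imp_le)
  qed
  then have "g (i mod n) \<noteq> g ((i + 2) mod n)" for i
    using g(2) inj_on_eq_iff[OF g(1), of "i mod n" "(i + 2) mod n"] by simp
  then have two: "k i \<noteq> k (i + 2)" for i
    using three_colors_on_cherry(1)[OF G edge[of i]] edge[of "i + 1"] by (simp add: k_def)
  have one: "k i \<noteq> k (i + 1)" and range: "k i \<in> {1..3}" for i
    using edge_colors_distinct(1,4)[OF G edge[of i]] by (simp_all add: k_def)
  have period: "k (i + 3) = k i" for i
    using one[of i] one[of "i + 1"] one[of "i + 2"] two[of i] two[of "i + 1"]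
    by (intro third_color_unique[of "k (i + 1)" "k (i + 2)"] range) (simp_all add: eval_nat_numeral)
  have "k (i + 3 * m) = k i" for i m
  proof (induction m)
    case (Suc m)
    then show ?case using period[of "i + 3 * m"] by (simp add: algebra_simps)
  qed simp
  from this[of "n mod 3" "n div 3"] have "k n = k (n mod 3)" by simp
  moreover have "k n = k 0" by (simp add: k_def)
  moreover have "n mod 3 = 0 \<or> n mod 3 = 1 \<or> n mod 3 = 2" by presburger
  ultimately show ?thesis
    using one[of 0] two[of 0] by (auto simp: numeral_2_eq_2)
qed

section \<open>Repeated colors at distance 2\<close>

text \<open>The color of \<open>u\<close> is repeated on the edge \<open>{v, w}\<close>, which is at distance 2 from \<open>u\<close>.\<close>

lemma cherry_end_color:
  assumes G: "simple_graph G" "packing_total_coloring a G 3 c" "\<And>i. 1 \<le> i \<Longrightarrow> 0 < a i"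
    and uv: "{u, v} \<in> edges G" and vw: "{v, w} \<in> edges G" and "u \<noteq> w"
  shows "a (c (Inl u)) = 1"
proof -
  have "Inl u \<in> verts G <+> edges G" "Inr {v, w} \<in> verts G <+> edges G"
    using edgeD[OF G(1) uv] vw by auto
  then have gt: "enat (a (c (Inl u))) < elem_dist G (Inl u) (Inr {v, w})"
    using G(2) three_colors_on_cherry(2)[OF G uv vw \<open>u \<noteq> w\<close>]
    unfolding packing_total_coloring_def by (metis Inl_Inr_False)
  have "elem_dist G (Inl u) (Inr {v, w}) \<le> vertex_dist G u v + 1"
    by (rule elem_dist_vertex_edge_le[OF G(1) vw]) simp
  also have "\<dots> \<le> 1 + 1"
    by (intro add_right_mono vertex_dist_adjacent_le[OF G(1) uv])
  finally have "enat (a (c (Inl u))) < 1 + 1"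
    by (rule less_le_trans[OF gt])
  then have "a (c (Inl u)) < 2" by (simp add: one_enat_def)
  moreover have "0 < a (c (Inl u))"
    using G(3) edge_colors_distinct(4)[OF G uv] by simp
  ultimately show ?thesis by simp
qed

text \<open>The colors of both ends are repeated at distance 2. They are different, so one of them is at
  least 2, and \<open>a\<close> is monotone.\<close>

lemma cherry_imp_a2:
  assumes G: "simple_graph G" "packing_total_coloring a G 3 c" "\<And>i. 1 \<le> i \<Longrightarrow> 0 < a i"
    and mono: "\<And>i j. 1 \<le> i \<Longrightarrow> i \<le> j \<Longrightarrow> a i \<le> a j"
    and uv: "{u, v} \<in> edges G" and vw: "{v, w} \<in> edges G" and "u \<noteq> w"
  shows "a 2 = 1"
proof -
  have a1: "a (c (Inl u)) = 1" "a (c (Inl w)) = 1"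
    using cherry_end_color[OF G uv vw] cherry_end_color[OF G, of w v u] uv vw \<open>u \<noteq> w\<close>
    by (auto simp: insert_commute)
  have "c (Inl u) \<noteq> c (Inl w)" "c (Inl u) \<in> {1..3}" "c (Inl w) \<in> {1..3}"
    using three_colors_on_cherry(1)[OF G uv vw \<open>u \<noteq> w\<close>] edge_colors_distinct(4)[OF G uv]
      edge_colors_distinct(5)[OF G vw] by auto
  then have "2 \<le> c (Inl u) \<or> 2 \<le> c (Inl w)" by auto
  then have "a 2 \<le> 1" using a1 mono[of 2] by fastforce
  then show ?thesis using G(3)[of 2] by simp
qed

text \<open>Each of \<open>v0\<close>, \<open>v1\<close> and \<open>v2\<close> is an outer end of two consecutive edges of the walk, so all three
  colors are repeated at distance 2. The vertices \<open>v0\<close> and \<open>v3\<close> may coincide, so a triangle is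
  covered.\<close>

lemma walk_imp_a3:
  assumes G: "simple_graph G" "packing_total_coloring a G 3 c" "\<And>i. 1 \<le> i \<Longrightarrow> 0 < a i"
    and e: "{v0, v1} \<in> edges G" "{v1, v2} \<in> edges G" "{v2, v3} \<in> edges G"
    and ne: "v0 \<noteq> v2" "v1 \<noteq> v3"
  shows "a 3 = 1"
proof -
  have a1: "a (c (Inl v0)) = 1" "a (c (Inl v1)) = 1" "a (c (Inl v2)) = 1"
    using cherry_end_color[OF G e(1,2) ne(1)] cherry_end_color[OF G e(2,3) ne(2)]
      cherry_end_color[OF G, of v2 v1 v0] e ne by (auto simp: insert_commute)
  have "c (Inl v0) \<noteq> c (Inl v2)" "c (Inl v0) \<noteq> c (Inl v1)" "c (Inl v1) \<noteq> c (Inl v2)"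
    "c (Inl v0) \<in> {1..3}" "c (Inl v1) \<in> {1..3}" "c (Inl v2) \<in> {1..3}"
    using three_colors_on_cherry(1)[OF G e(1,2) ne(1)] edge_colors_distinct[OF G e(1)]
      edge_colors_distinct[OF G e(2)] by auto
  then have "c (Inl v0) = 3 \<or> c (Inl v1) = 3 \<or> c (Inl v2) = 3" by auto
  then show ?thesis using a1 by auto
qed

section \<open>The characterization\<close>

theorem proposition6:
  fixes a :: "nat \<Rightarrow> nat" and G :: "'a ugraph"
  assumes "\<And>i. 1 \<le> i \<Longrightarrow> 0 < a i"
    and "\<And>i j. 1 \<le> i \<Longrightarrow> i \<le> j \<Longrightarrow> a i \<le> a j"
    and "simple_graph G"
    and "connected_graph G"
  shows "(a 3 = 1 \<longrightarrow>
            (packing_total_chromatic_number a G = 3 \<longleftrightarrow>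
               (\<exists>n\<ge>2. graph_iso G (path_graph n)) \<or>
               (\<exists>n\<ge>3. n mod 3 = 0 \<and> graph_iso G (cycle_graph n)))) \<and>
         (a 3 \<ge> 2 \<and> a 2 = 1 \<longrightarrow>
            (packing_total_chromatic_number a G = 3 \<longleftrightarrow>
               graph_iso G (path_graph 2) \<or> graph_iso G (path_graph 3))) \<and>
         (a 3 \<ge> 2 \<and> a 2 \<ge> 2 \<longrightarrow>
            (packing_total_chromatic_number a G = 3 \<longleftrightarrow> graph_iso G (path_graph 2)))"
proof -
  note G = assms(3,4) and pos = assms(1) and mono = assms(2)
  note chi = chromatic_number_3_iff[of G a, OF G pos]
  have shape: "(\<exists>n\<ge>2. graph_iso G (path_graph n) \<and> (a 3 = 1 \<or> n \<le> 3) \<and> (a 2 = 1 \<or> n \<le> 2)) \<or>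
      (\<exists>n\<ge>3. n mod 3 = 0 \<and> graph_iso G (cycle_graph n) \<and> a 3 = 1)"
    if three: "packing_total_chromatic_number a G = 3"
  proof -
    obtain c where c: "packing_total_coloring a G 3 c" and E: "edges G \<noteq> {}"
      using three chi by blast
    note col = G(1) c pos
    have "(\<exists>n. graph_iso G (path_graph n)) \<or> (\<exists>n\<ge>3. graph_iso G (cycle_graph n))"
      by (rule path_or_cycle[OF G]) (rule at_most_two_neighbors[OF col])
    then consider n where "graph_iso G (path_graph n)" | n where "3 \<le> n" "graph_iso G (cycle_graph n)"
      by blast
    then show ?thesis
    proof cases
      case 1
      then obtain g where g: "bij_betw g {..<n} (verts G)"
        and e: "\<And>i j. i < n \<Longrightarrow> j < n \<Longrightarrow> {i, j} \<in> edges (path_graph n) \<longleftrightarrow> {g i, g j} \<in> edges G"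
        using graph_iso_sym[OF 1] unfolding graph_iso_def by (auto simp: path_graph_def)
      have edge: "{g i, g (i + 1)} \<in> edges G" if "i + 1 < n" for i
        using e[of i "i + 1"] that by (simp add: path_graph_edge_iff)
      have ne: "g i \<noteq> g (i + 2)" if "i + 2 < n" for i
        using inj_on_eq_iff[OF bij_betw_imp_inj_on[OF g], of i "i + 2"] that by simp
      obtain u v where uv: "{u, v} \<in> edges G"
        using E edge_obtain[OF G(1)] by (metis ex_in_conv)
      then have "u \<in> g ` {..<n}" "v \<in> g ` {..<n}" "u \<noteq> v"
        using edgeD[OF G(1) uv] g by (auto simp: bij_betw_def)
      then obtain i j where "i < n" "j < n" "g i \<noteq> g j" by auto
      then have "2 \<le> n" by (cases "i = j") auto
      moreover have "a 3 = 1" if "\<not> n \<le> 3"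
      proof (rule walk_imp_a3[OF col])
        show "{g 0, g 1} \<in> edges G" "{g 1, g 2} \<in> edges G" "{g 2, g 3} \<in> edges G"
          using edge[of 0] edge[of 1] edge[of 2] that by (simp_all add: eval_nat_numeral)
        show "g 0 \<noteq> g 2" "g 1 \<noteq> g 3"
          using ne[of 0] ne[of 1] that by (simp_all add: eval_nat_numeral)
      qed
      moreover have "a 2 = 1" if "\<not> n \<le> 2"
      proof (rule cherry_imp_a2[OF col mono])
        show "{g 0, g 1} \<in> edges G" "{g 1, g 2} \<in> edges G"
          using edge[of 0] edge[of 1] that by (simp_all add: eval_nat_numeral)
        show "g 0 \<noteq> g 2"
          using ne[of 0] that by (simp add: eval_nat_numeral)
      qed
      ultimately show ?thesis using 1 by blast
    next
      case 2
      then obtain g where g: "bij_betw g {..<n} (verts G)"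
        and e: "\<And>i j. i < n \<Longrightarrow> j < n \<Longrightarrow> {i, j} \<in> edges (cycle_graph n) \<longleftrightarrow> {g i, g j} \<in> edges G"
        using graph_iso_sym[OF 2(2)] unfolding graph_iso_def by (auto simp: cycle_graph_def)
      have inj: "inj_on g {..<n}" using g by (simp add: bij_betw_def)
      have edge: "{g i, g ((i + 1) mod n)} \<in> edges G" if "i < n" for i
        using e[of i "(i + 1) mod n"] that by (simp add: cycle_graph_edge_iff)
      have "n mod 3 = 0"
        by (rule cycle_length_mod_3[OF col inj 2(1) edge])
      moreover have "a 3 = 1"
      proof (rule walk_imp_a3[OF col])
        show "{g 0, g 1} \<in> edges G" "{g 1, g 2} \<in> edges G" "{g 2, g (3 mod n)} \<in> edges G"
          using edge[of 0] edge[of 1] edge[of 2] 2(1) by (simp_all add: eval_nat_numeral)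
        show "g 0 \<noteq> g 2" using inj_on_eq_iff[OF inj, of 0 2] 2(1) by simp
        have "3 mod n \<noteq> 1" using 2(1) by (cases "n = 3") auto
        then show "g 1 \<noteq> g (3 mod n)" using inj_on_eq_iff[OF inj, of 1 "3 mod n"] 2(1) by simp
      qed
      ultimately show ?thesis using 2 by (intro disjI2 exI[of _ n]) simp
    qed
  qed
  have path: "packing_total_chromatic_number a G = 3"
    if iso: "graph_iso G (path_graph n)" and n: "2 \<le> n" "a 3 = 1 \<or> a 2 = 1 \<and> n \<le> 3 \<or> n \<le> 2" for n
  proof -
    obtain f where "\<forall>i\<in>verts (path_graph n). \<forall>j\<in>verts (path_graph n).
        {i, j} \<in> edges (path_graph n) \<longleftrightarrow> {f i, f j} \<in> edges G"
      using graph_iso_sym[OF iso] unfolding graph_iso_def by blast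
    moreover have "{0, 1} \<in> edges (path_graph n)"
      using n(1) path_graph_edge_iff[of 0 1 n] by simp
    ultimately have "{f 0, f 1} \<in> edges G"
      using n(1) by (auto simp: path_graph_def)
    then show ?thesis
      using chi path_packing_total_coloring[of G a n, OF G(1) pos mono iso n(2)] by auto
  qed
  have cycle: "packing_total_chromatic_number a G = 3"
    if iso: "graph_iso G (cycle_graph n)" and n: "3 \<le> n" "n mod 3 = 0" "a 3 = 1" for n
  proof -
    obtain f where "\<forall>i\<in>verts (cycle_graph n). \<forall>j\<in>verts (cycle_graph n).
        {i, j} \<in> edges (cycle_graph n) \<longleftrightarrow> {f i, f j} \<in> edges G"
      using graph_iso_sym[OF iso] unfolding graph_iso_def by blast
    moreover have "{0, 1} \<in> edges (cycle_graph n)"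
      using n(1) cycle_graph_edge_iff[of 0 1 n] by simp
    ultimately have "{f 0, f 1} \<in> edges G"
      using n(1) by (auto simp: cycle_graph_def)
    then show ?thesis
      using chi cycle_packing_total_coloring[of G a n, OF G(1) pos mono iso n(2,3)] by auto
  qed
  have small: "n = 2 \<or> n = 3" if "2 \<le> n" "n \<le> 3" for n :: nat
    using that by auto
  show ?thesis
  proof (intro conjI impI)
    assume a3: "a 3 = 1"
    show "packing_total_chromatic_number a G = 3 \<longleftrightarrow>
        (\<exists>n\<ge>2. graph_iso G (path_graph n)) \<or>
        (\<exists>n\<ge>3. n mod 3 = 0 \<and> graph_iso G (cycle_graph n))"
      (is "_ \<longleftrightarrow> ?paths \<or> ?cycles")
    proof
      assume "packing_total_chromatic_number a G = 3"
      from shape[OF this] show "?paths \<or> ?cycles" by (elim disjE) auto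
    next
      assume "?paths \<or> ?cycles"
      then show "packing_total_chromatic_number a G = 3"
        using path cycle a3 by (elim disjE exE conjE) simp_all
    qed
  next
    assume A: "a 3 \<ge> 2 \<and> a 2 = 1"
    show "packing_total_chromatic_number a G = 3 \<longleftrightarrow>
        graph_iso G (path_graph 2) \<or> graph_iso G (path_graph 3)"
    proof
      assume "packing_total_chromatic_number a G = 3"
      with shape A obtain n where "2 \<le> n" "n \<le> 3" "graph_iso G (path_graph n)" by fastforce
      then show "graph_iso G (path_graph 2) \<or> graph_iso G (path_graph 3)"
        using small by blast
    next
      assume "graph_iso G (path_graph 2) \<or> graph_iso G (path_graph 3)"
      then show "packing_total_chromatic_number a G = 3"
        using path[of 2] path[of 3] A by linarith
    qed
  next
    assume A: "a 3 \<ge> 2 \<and> a 2 \<ge> 2"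
    show "packing_total_chromatic_number a G = 3 \<longleftrightarrow> graph_iso G (path_graph 2)"
    proof
      assume "packing_total_chromatic_number a G = 3"
      with shape A obtain n where "2 \<le> n" "n \<le> 2" "graph_iso G (path_graph n)" by fastforce
      then show "graph_iso G (path_graph 2)" by (metis le_antisym)
    next
      assume "graph_iso G (path_graph 2)"
      then show "packing_total_chromatic_number a G = 3" using path[of 2] by simp
    qed
  qed
qed

end
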